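(* Let $X$ be a finite connected poset with $|X|>1$, let $K$ be a field, and let $\varphi$ be a Lie automorphism of $I(X,K)$. Then $\varphi$ is a regular Hom-Lie structure on $I(X,K)$ if and only if $\varphi=\xi_\beta\circ M_\sigma+\nu$, where - $\beta\in I(X,K)^*$ satisfies $\beta_D=\delta$ and $\beta_J\in Z(J(I(X,K)))$; - $\sigma\in I(X,K)$ is multiplicative and satisfies $\sigma(x,y)=1$ for all $x<y$ unless $x\in\mathrm{Min}(X)$ and $y\in\mathrm{Max}(X)$; - $\nu:I(X,K)\to I(X,K)$ is a linear map with values in the center of $I(X,K)$ and with $\nu(J(I(X,K)))=0$. Moreover, such $\beta$, $\sigma$ and $\nu$ are unique.
   Context: $I(X,K)$ is the incidence algebra: the $K$-algebra with basis $\{e_{xy}: x\le y\}$ and product $e_{xy}e_{uv}=e_{xv}$ if $y=u$ and $0$ otherwise; $e_x:=e_{xx}$; $\delta=\sum_{x\in X}e_x$ is the identity; each $f\in I(X,K)$ is written $f=\sum_{x\le y}f(x,y)e_{xy}$; $I(X,K)^*$ is the group of units. $J(I(X,K))=\mathrm{Span}_K\{e_{xy}:x<y\}$ is the Jacobson radical, $Z(J(I(X,K)))$ is its center, equal to $\mathrm{Span}_K\{e_{xy}:x<y,\ x\in\mathrm{Min}(X),\,y\in\mathrm{Max}(X)\}$, where $\mathrm{Min}(X)$, $\mathrm{Max}(X)$ are the sets of minimal and maximal elements of $X$. $D(X,K)=\mathrm{Span}_K\{e_x:x\in X\}$; each $f$ is uniquely $f=f_D+f_J$ with $f_D\in D(X,K)$,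 $f_J\in J(I(X,K))$. $I(X,K)$ is regarded as a Lie algebra with $[f,g]=fg-gf$; a Lie automorphism is a linear bijection preserving $[\cdot,\cdot]$. The center of $I(X,K)$ is $K\delta$. $\xi_\beta(f)=\beta f\beta^{-1}$ for $\beta\in I(X,K)^*$. An element $\sigma\in I(X,K)$ is multiplicative if $\sigma(x,y)\ne0$ for all $x\le y$ and $\sigma(x,z)=\sigma(x,y)\sigma(y,z)$ whenever $x\le y\le z$ (so $\sigma(x,x)=1$); then $M_\sigma$ is the automorphism of $I(X,K)$ given by $M_\sigma(f)(x,y)=\sigma(x,y)f(x,y)$. A regular Hom-Lie structure on a Lie algebra $L$ is an automorphism $\varphi$ of the Lie algebra $L$ satisfying $[[a,b],\varphi(c)]+[[b,c],\varphi(a)]+[[c,a],\varphi(b)]=0$ for all $a,b,c\in L$. *)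

theory Defs
  imports Complex_Main "HOL-Library.Cardinality"
begin

section \<open>Finite posets\<close>

text \<open>A finite poset is a type of class \<open>{finite, order}\<close>. It is connected if any two elements are
  joined by a finite chain of successively comparable elements.\<close>

definition connected_poset :: "'a::order itself \<Rightarrow> bool" where
  "connected_poset _ \<longleftrightarrow> (\<forall>x y::'a. (\<lambda>u v. u \<le> v \<or> v \<le> u)\<^sup>*\<^sup>* x y)"

definition Min_elems :: "'a::order set" where
  "Min_elems = {x. \<not> (\<exists>y. y < x)}"

definition Max_elems :: "'a::order set" where
  "Max_elems = {x. \<not> (\<exists>y. x < y)}"


section \<open>The incidence algebra\<close>

text \<open>Elements of the incidence algebra are identified with their coefficient functions, i.e.
  with functions of two arguments vanishing off the order relation; \<open>coef f x y\<close> is $f(x,y)$.\<close>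

typedef (overloaded) ('a::"{finite,order}", 'k::field) incidence =
  "{f :: 'a \<Rightarrow> 'a \<Rightarrow> 'k. \<forall>x y. \<not> x \<le> y \<longrightarrow> f x y = 0}"
  morphisms coef Abs_incidence
  by (rule exI[of _ "\<lambda>_ _. 0"]) simp

setup_lifting type_definition_incidence

lemma coef_eq_0: "\<not> x \<le> y \<Longrightarrow> coef f x y = 0"
  using coef[of f] by blast

lemma incidence_eqI: "(\<And>x y. x \<le> y \<Longrightarrow> coef f x y = coef g x y) \<Longrightarrow> f = g"
  by (metis coef_eq_0 coef_inject ext)

instantiation incidence :: ("{finite,order}", field) ring_1
begin

lift_definition zero_incidence :: "('a, 'b) incidence" is "\<lambda>_ _. 0" by simp

lift_definition one_incidence :: "('a, 'b) incidence" is "\<lambda>x y. if x = y then 1 else 0" by simp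

lift_definition plus_incidence :: "('a, 'b) incidence \<Rightarrow> ('a, 'b) incidence \<Rightarrow> ('a, 'b) incidence"
  is "\<lambda>f g x y. f x y + g x y" by simp

lift_definition minus_incidence :: "('a, 'b) incidence \<Rightarrow> ('a, 'b) incidence \<Rightarrow> ('a, 'b) incidence"
  is "\<lambda>f g x y. f x y - g x y" by simp

lift_definition uminus_incidence :: "('a, 'b) incidence \<Rightarrow> ('a, 'b) incidence"
  is "\<lambda>f x y. - f x y" by simp

lift_definition times_incidence :: "('a, 'b) incidence \<Rightarrow> ('a, 'b) incidence \<Rightarrow> ('a, 'b) incidence"
  is "\<lambda>f g x y. \<Sum>z\<in>{x..y}. f x z * g z y" by simp

lemma coef_times_UNIV:
  "coef (f * g) x y = (\<Sum>z\<in>UNIV. coef f x z * coef g z y)"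
  unfolding times_incidence.rep_eq
  by (rule sum.mono_neutral_left) (use coef_eq_0 in fastforce)+

instance
proof
  fix f g h :: "('a, 'b) incidence"
  show "f * g * h = f * (g * h)"
  proof (rule incidence_eqI)
    fix x y :: 'a
    have "coef (f * g * h) x y = (\<Sum>z\<in>UNIV. \<Sum>w\<in>UNIV. coef f x w * coef g w z * coef h z y)"
      by (simp add: coef_times_UNIV sum_distrib_right)
    also have "\<dots> = (\<Sum>w\<in>UNIV. \<Sum>z\<in>UNIV. coef f x w * coef g w z * coef h z y)"
      by (rule sum.swap)
    also have "\<dots> = coef (f * (g * h)) x y"
      by (simp add: coef_times_UNIV sum_distrib_left mult.assoc)
    finally show "coef (f * g * h) x y = coef (f * (g * h)) x y" .
  qed
  show "f + g + h = f + (g + h)" "f + g = g + f" "0 + f = f" "- f + f = 0" "f - g = f + - g"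
    by (transfer; simp add: algebra_simps)+
  show "1 * f = f" "f * 1 = f"
    by (rule incidence_eqI;
        simp add: coef_times_UNIV one_incidence.rep_eq if_distrib if_distribR sum.delta' sum.delta
          cong: if_cong)+
  show "(f + g) * h = f * h + g * h" "f * (g + h) = f * g + f * h"
    by (rule incidence_eqI;
        simp add: coef_times_UNIV plus_incidence.rep_eq algebra_simps sum.distrib)+
  have "coef (0 :: ('a, 'b) incidence) x x \<noteq> coef 1 x x" for x
    by (simp add: zero_incidence.rep_eq one_incidence.rep_eq)
  then show "0 \<noteq> (1 :: ('a, 'b) incidence)" by metis
qed

end

lift_definition scaleK :: "'k::field \<Rightarrow> ('a::{finite,order}, 'k) incidence \<Rightarrow> ('a, 'k) incidence"
  is "\<lambda>c f x y. c * f x y" by simp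

notation scaleK (infixr \<open>*\<^sub>K\<close> 75)

lemmas coef_simps = zero_incidence.rep_eq one_incidence.rep_eq plus_incidence.rep_eq
  minus_incidence.rep_eq uminus_incidence.rep_eq scaleK.rep_eq

lemma scaleK_times: "(c *\<^sub>K f) * g = c *\<^sub>K (f * g)" "f * (c *\<^sub>K g) = c *\<^sub>K (f * g)"
  by (rule incidence_eqI; simp add: coef_times_UNIV coef_simps sum_distrib_left mult_ac)+

text \<open>The basis element $e_{xy}$. It is only meaningful for \<open>x \<le> y\<close>; otherwise \<open>bas x y = 0\<close>.\<close>

lift_definition bas :: "'a::{finite,order} \<Rightarrow> 'a \<Rightarrow> ('a, 'k::field) incidence"
  is "\<lambda>x y u v. if x \<le> y \<and> u = x \<and> v = y then 1 else 0" by auto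

lemma bas_times_bas:
  assumes "x \<le> y" "u \<le> v"
  shows "bas x y * bas u v = (if y = u then bas x v else 0)"
proof (rule incidence_eqI)
  fix p q :: 'a
  have "coef (bas x y * bas u v :: ('a, 'b) incidence) p q
      = (\<Sum>z\<in>UNIV. if z = y then (if p = x \<and> y = u \<and> q = v then 1 else 0) else 0)"
    unfolding coef_times_UNIV by (rule sum.cong) (use assms in \<open>auto simp: bas.rep_eq\<close>)
  then show "coef (bas x y * bas u v :: ('a, 'b) incidence) p q
      = coef (if y = u then bas x v else 0) p q"
    using assms by (auto simp: bas.rep_eq coef_simps)
qed


section \<open>Lie algebras and Hom-Lie structures\<close>

locale lie_algebra = vector_space scale
  for scale :: "'k::field \<Rightarrow> 'l::ab_group_add \<Rightarrow> 'l" +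
  fixes bracket :: "'l \<Rightarrow> 'l \<Rightarrow> 'l"
  assumes bracket_add_left: "bracket (a + b) c = bracket a c + bracket b c"
    and bracket_add_right: "bracket a (b + c) = bracket a b + bracket a c"
    and bracket_scale_left: "bracket (scale r a) b = scale r (bracket a b)"
    and bracket_scale_right: "bracket a (scale r b) = scale r (bracket a b)"
    and bracket_self: "bracket a a = 0"
    and jacobi: "bracket (bracket a b) c + bracket (bracket b c) a + bracket (bracket c a) b = 0"
begin

definition lie_automorphism :: "('l \<Rightarrow> 'l) \<Rightarrow> bool" where
  "lie_automorphism \<phi> \<longleftrightarrow>
     Vector_Spaces.linear scale scale \<phi> \<and> bij \<phi> \<and>
     (\<forall>a b. \<phi> (bracket a b) = bracket (\<phi> a) (\<phi> b))"

definition regular_hom_lie :: "('l \<Rightarrow> 'l) \<Rightarrow> bool" where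
  "regular_hom_lie \<phi> \<longleftrightarrow> lie_automorphism \<phi> \<and>
     (\<forall>a b c. bracket (bracket a b) (\<phi> c) + bracket (bracket b c) (\<phi> a)
            + bracket (bracket c a) (\<phi> b) = 0)"

end

definition commutator :: "'r::ring \<Rightarrow> 'r \<Rightarrow> 'r" where
  "commutator f g = f * g - g * f"

global_interpretation incidence: lie_algebra
  "(*\<^sub>K) :: 'k::field \<Rightarrow> ('a::{finite,order}, 'k) incidence \<Rightarrow> ('a, 'k) incidence" commutator
proof
  fix a b c :: "('a::{finite,order}, 'k::field) incidence" and r s :: 'k
  show "r *\<^sub>K (a + b) = r *\<^sub>K a + r *\<^sub>K b" "(r + s) *\<^sub>K a = r *\<^sub>K a + s *\<^sub>K a"
    "r *\<^sub>K s *\<^sub>K a = (r * s) *\<^sub>K a" "1 *\<^sub>K a = a"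
    by (rule incidence_eqI; simp add: coef_simps algebra_simps)+
  show "commutator (r *\<^sub>K a) b = r *\<^sub>K commutator a b"
    "commutator a (r *\<^sub>K b) = r *\<^sub>K commutator a b"
    unfolding commutator_def scaleK_times
    by (rule incidence_eqI; simp add: coef_simps algebra_simps)+
qed (simp_all add: commutator_def algebra_simps)


section \<open>Radical, center and diagonal part\<close>

definition center_of :: "'r::ring set \<Rightarrow> 'r set" where
  "center_of S = {f \<in> S. \<forall>g\<in>S. f * g = g * f}"

definition J :: "('a::{finite,order}, 'k::field) incidence set" where
  "J = incidence.span {bas x y | x y. x < y}"

definition D :: "('a::{finite,order}, 'k::field) incidence set" where
  "D = incidence.span {bas x x | x. True}"

lift_definition part_D :: "('a::{finite,order}, 'k::field) incidence \<Rightarrow> ('a, 'k) incidence"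
  is "\<lambda>f x y. if x = y then f x y else 0" by simp

lift_definition part_J :: "('a::{finite,order}, 'k::field) incidence \<Rightarrow> ('a, 'k) incidence"
  is "\<lambda>f x y. if x = y then 0 else f x y" by simp

lemma coef_sum: "coef (sum F A) x y = (\<Sum>a\<in>A. coef (F a) x y)"
  by (induction A rule: infinite_finite_induct) (auto simp: coef_simps)

lemma incidence_expansion:
  "f = (\<Sum>(u, v)\<in>{(u, v). u \<le> v}. coef f u v *\<^sub>K bas u v)"
proof (rule incidence_eqI)
  fix x y :: 'a assume le: "x \<le> y"
  have "coef (\<Sum>(u, v)\<in>{(u, v). u \<le> v}. coef f u v *\<^sub>K bas u v) x y
     = (\<Sum>p\<in>{(u, v). u \<le> v}. if p = (x, y) then coef f x y else 0)"
    unfolding coef_sum by (rule sum.cong) (auto simp: coef_simps bas.rep_eq split: if_splits)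
  also have "\<dots> = coef f x y" using le by simp
  finally show "coef f x y = coef (\<Sum>(u, v)\<in>{(u, v). u \<le> v}. coef f u v *\<^sub>K bas u v) x y" ..
qed

lemma J_iff: "f \<in> J \<longleftrightarrow> (\<forall>x. coef f x x = 0)"
proof
  assume "f \<in> J"
  then show "\<forall>x. coef f x x = 0"
    unfolding J_def
    by (induction rule: incidence.span_induct_alt) (auto simp: coef_simps bas.rep_eq split: if_splits)
next
  assume f: "\<forall>x. coef f x x = 0"
  have "(\<Sum>(u, v)\<in>{(u, v). u \<le> v}. coef f u v *\<^sub>K bas u v) \<in> J"
    unfolding J_def
  proof (rule incidence.span_sum, clarify)
    fix u v :: 'a assume "u \<le> v"
    show "coef f u v *\<^sub>K bas u v \<in> incidence.span {bas x y | x y. x < y}"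
    proof (cases "u = v")
      case True
      then show ?thesis using f by (simp add: incidence.span_zero)
    next
      case False
      then show ?thesis using \<open>u \<le> v\<close>
        by (intro incidence.span_scale incidence.span_base) (auto simp: order.strict_iff_order)
    qed
  qed
  then show "f \<in> J" by (simp flip: incidence_expansion)
qed

lemma D_iff: "f \<in> D \<longleftrightarrow> (\<forall>x y. x \<noteq> y \<longrightarrow> coef f x y = 0)"
proof
  assume "f \<in> D"
  then show "\<forall>x y. x \<noteq> y \<longrightarrow> coef f x y = 0"
    unfolding D_def
    by (induction rule: incidence.span_induct_alt) (auto simp: coef_simps bas.rep_eq split: if_splits)
next
  assume f: "\<forall>x y. x \<noteq> y \<longrightarrow> coef f x y = 0"
  have "(\<Sum>(u, v)\<in>{(u, v). u \<le> v}. coef f u v *\<^sub>K bas u v) \<in> D"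
    unfolding D_def
  proof (rule incidence.span_sum, clarify)
    fix u v :: 'a assume "u \<le> v"
    show "coef f u v *\<^sub>K bas u v \<in> incidence.span {bas x x | x. True}"
    proof (cases "u = v")
      case True
      then show ?thesis
        by (intro incidence.span_scale incidence.span_base) auto
    next
      case False
      then show ?thesis using f by (simp add: incidence.span_zero)
    qed
  qed
  then show "f \<in> D" by (simp flip: incidence_expansion)
qed

lemma part_D_part_J:
  "f = part_D f + part_J f" "part_D f \<in> D" "part_J f \<in> J"
  by (auto simp: J_iff D_iff part_D.rep_eq part_J.rep_eq coef_simps intro: incidence_eqI)

lemma part_D_part_J_unique:
  assumes "f = d + j" "d \<in> D" "j \<in> J"
  shows "d = part_D f" "j = part_J f"
  using assms
  by (auto simp: J_iff D_iff part_D.rep_eq part_J.rep_eq coef_simps intro!: incidence_eqI)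


section \<open>The span \<open>J\<close> is the Jacobson radical\<close>

definition left_ideal :: "'r::ring_1 set \<Rightarrow> bool" where
  "left_ideal L \<longleftrightarrow> 0 \<in> L \<and> (\<forall>a\<in>L. \<forall>b\<in>L. a + b \<in> L) \<and> (\<forall>r. \<forall>a\<in>L. r * a \<in> L)"

definition maximal_left_ideal :: "'r::ring_1 set \<Rightarrow> bool" where
  "maximal_left_ideal M \<longleftrightarrow>
     left_ideal M \<and> M \<noteq> UNIV \<and> (\<forall>L. left_ideal L \<longrightarrow> M \<subseteq> L \<longrightarrow> L = M \<or> L = UNIV)"

definition jacobson_radical :: "'r::ring_1 set" where
  "jacobson_radical = \<Inter> {M. maximal_left_ideal M}"

lemma coef_times_diag: "coef (f * g) x x = coef f x x * coef g x x"
  by (simp add: times_incidence.rep_eq)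

lemma J_power_support:
  assumes "h \<in> J" "coef (h ^ n) x y \<noteq> 0"
  shows "n < card {x..y}"
  using assms(2)
proof (induction n arbitrary: x)
  case 0
  then have "x = y" by (auto simp: coef_simps split: if_splits)
  then show ?case by simp
next
  case (Suc n)
  then obtain z where z: "z \<in> {x..y}" "coef h x z \<noteq> 0" "coef (h ^ n) z y \<noteq> 0"
    by (auto simp: times_incidence.rep_eq elim!: sum.not_neutral_contains_not_neutral)
  from z(2) assms(1) have "x \<noteq> z" by (auto simp: J_iff)
  with z(1) have "{z..y} \<subset> {x..y}" by auto
  then have "card {z..y} < card {x..y}" by (intro psubset_card_mono) auto
  with Suc.IH[OF z(3)] show ?case by simp
qed

lemma J_nilpotent:
  fixes h :: "('a::{finite,order}, 'k::field) incidence"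
  assumes "h \<in> J"
  shows "h ^ CARD('a) = 0"
proof (rule incidence_eqI, rule ccontr)
  fix x y :: 'a
  assume "coef (h ^ CARD('a)) x y \<noteq> coef 0 x y"
  then have "CARD('a) < card {x..y}"
    using J_power_support[OF assms] by (simp add: coef_simps)
  moreover have "card {x..y} \<le> CARD('a)" by (rule card_mono) auto
  ultimately show False by simp
qed

lemma geometric_left: "(\<Sum>i<n. h ^ i) * (1 - h) = 1 - (h::'r::ring_1) ^ n"
  by (induction n) (simp_all add: distrib_right right_diff_distrib power_commutes, simp add: algebra_simps)

lemma J_eq_jacobson_radical:
  "(J :: ('a::{finite,order}, 'k::field) incidence set) = jacobson_radical"
proof (intro equalityI subsetI)
  fix f :: "('a, 'k) incidence" assume f: "f \<in> J"
  show "f \<in> jacobson_radical"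
    unfolding jacobson_radical_def
  proof (safe, rule ccontr)
    fix M :: "('a, 'k) incidence set"
    assume M: "maximal_left_ideal M" and fM: "f \<notin> M"
    define L where "L = {m + g * f | m g. m \<in> M}"
    have lM: "left_ideal M" using M by (simp add: maximal_left_ideal_def)
    have "left_ideal L"
      unfolding left_ideal_def
    proof (intro conjI ballI allI)
      have "0 = 0 + 0 * f" by simp
      then show "0 \<in> L" using lM unfolding L_def left_ideal_def by blast
    next
      fix a b assume "a \<in> L" "b \<in> L"
      then obtain m g m' g' where "a = m + g * f" "b = m' + g' * f" "m \<in> M" "m' \<in> M"
        unfolding L_def by blast
      then have "a + b = (m + m') + (g + g') * f" "m + m' \<in> M"
        using lM by (auto simp: algebra_simps left_ideal_def)
      then show "a + b \<in> L" unfolding L_def by blast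
    next
      fix r a assume "a \<in> L"
      then obtain m g where "a = m + g * f" "m \<in> M"
        unfolding L_def by blast
      then have "r * a = r * m + (r * g) * f" "r * m \<in> M"
        using lM by (auto simp: algebra_simps left_ideal_def)
      then show "r * a \<in> L" unfolding L_def by blast
    qed
    moreover have "M \<subseteq> L"
    proof
      fix m assume "m \<in> M"
      moreover have "m = m + 0 * f" by simp
      ultimately show "m \<in> L" unfolding L_def by blast
    qed
    moreover have "f \<in> L"
    proof -
      have "f = 0 + 1 * f" by simp
      then show ?thesis using lM unfolding L_def left_ideal_def by blast
    qed
    ultimately have "L = UNIV" using M fM by (auto simp: maximal_left_ideal_def)
    then obtain m g where mg: "1 = m + g * f" "m \<in> M" unfolding L_def by blast
    have h: "g * f \<in> J" using f by (simp add: J_iff coef_times_diag)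
    have "(\<Sum>i<CARD('a). (g * f) ^ i) * m = 1"
    proof -
      have "m = 1 - g * f" using mg(1) by (simp add: algebra_simps)
      then show ?thesis using J_nilpotent[OF h] by (simp add: geometric_left)
    qed
    then have "1 \<in> M" using lM mg(2) unfolding left_ideal_def by metis
    then have "M = UNIV" using lM unfolding left_ideal_def by (metis UNIV_eq_I mult.right_neutral)
    then show False using M by (simp add: maximal_left_ideal_def)
  qed
next
  fix f :: "('a, 'k) incidence" assume f: "f \<in> jacobson_radical"
  have "coef f x x = 0" for x
  proof -
    define M where "M = {g :: ('a, 'k) incidence. coef g x x = 0}"
    have lM: "left_ideal M"
      by (auto simp: left_ideal_def M_def coef_simps coef_times_diag)
    have "1 \<notin> M" by (simp add: M_def coef_simps)
    have "L = UNIV" if L: "left_ideal L" "M \<subseteq> L" "L \<noteq> M" for L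
    proof -
      obtain g where g: "g \<in> L" "coef g x x \<noteq> 0" using L by (auto simp: M_def)
      define r where "r = inverse (coef g x x) *\<^sub>K (1 :: ('a, 'k) incidence)"
      have "1 - r * g \<in> M"
        using g(2) by (simp add: M_def r_def coef_simps coef_times_diag)
      then have "r * g + (1 - r * g) \<in> L" using L g unfolding left_ideal_def by blast
      then have "1 \<in> L" by simp
      then show ?thesis using L(1) unfolding left_ideal_def
        by (metis UNIV_eq_I mult.right_neutral)
    qed
    then have "maximal_left_ideal M"
      using lM \<open>1 \<notin> M\<close> by (auto simp: maximal_left_ideal_def)
    then show ?thesis using f by (auto simp: jacobson_radical_def M_def)
  qed
  then show "f \<in> J" by (simp add: J_iff)
qed


section \<open>Inner and multiplicative automorphisms\<close>

definition ring_unit :: "'r::ring_1 \<Rightarrow> bool" where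
  "ring_unit b \<longleftrightarrow> (\<exists>c. b * c = 1 \<and> c * b = 1)"

text \<open>Unspecified unless \<open>b\<close> is a unit.\<close>

definition unit_inv :: "'r::ring_1 \<Rightarrow> 'r" where
  "unit_inv b = (THE c. b * c = 1 \<and> c * b = 1)"

lemma unit_inv:
  assumes "ring_unit b"
  shows "b * unit_inv b = 1" "unit_inv b * b = 1"
proof -
  have "\<exists>!c. b * c = 1 \<and> c * b = 1"
    using assms unfolding ring_unit_def by (metis mult.assoc mult.left_neutral mult.right_neutral)
  from theI'[OF this] show "b * unit_inv b = 1" "unit_inv b * b = 1"
    unfolding unit_inv_def by blast+
qed

definition inner_aut :: "'r::ring_1 \<Rightarrow> 'r \<Rightarrow> 'r" (\<open>\<xi>\<close>) where
  "\<xi> \<beta> f = \<beta> * f * unit_inv \<beta>"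

definition multiplicative :: "('a::{finite,order}, 'k::field) incidence \<Rightarrow> bool" where
  "multiplicative \<sigma> \<longleftrightarrow>
     (\<forall>x y. x \<le> y \<longrightarrow> coef \<sigma> x y \<noteq> 0) \<and>
     (\<forall>x y z. x \<le> y \<longrightarrow> y \<le> z \<longrightarrow> coef \<sigma> x z = coef \<sigma> x y * coef \<sigma> y z)"

lift_definition mult_aut ::
  "('a::{finite,order}, 'k::field) incidence \<Rightarrow> ('a, 'k) incidence \<Rightarrow> ('a, 'k) incidence"
  is "\<lambda>\<sigma> f x y. \<sigma> x y * f x y" by simp


section \<open>The three parameters of the decomposition\<close>

definition admissible_beta :: "('a::{finite,order}, 'k::field) incidence \<Rightarrow> bool" where
  "admissible_beta \<beta> \<longleftrightarrow> ring_unit \<beta> \<and> part_D \<beta> = 1 \<and> part_J \<beta> \<in> center_of J"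

definition admissible_sigma :: "('a::{finite,order}, 'k::field) incidence \<Rightarrow> bool" where
  "admissible_sigma \<sigma> \<longleftrightarrow> multiplicative \<sigma> \<and>
     (\<forall>x y. x < y \<longrightarrow> \<not> (x \<in> Min_elems \<and> y \<in> Max_elems) \<longrightarrow> coef \<sigma> x y = 1)"

definition admissible_nu ::
  "(('a::{finite,order}, 'k::field) incidence \<Rightarrow> ('a, 'k) incidence) \<Rightarrow> bool" where
  "admissible_nu \<nu> \<longleftrightarrow> Vector_Spaces.linear (*\<^sub>K) (*\<^sub>K) \<nu> \<and>
     range \<nu> \<subseteq> center_of UNIV \<and> \<nu> ` J = {0}"

end

theory Submission
  imports Defs
begin

text \<open>Write \<open>F z = \<phi> (e\<^sub>z)\<close>. The Hom-Lie identity forces \<open>[e\<^sub>x\<^sub>y, F z] = 0\<close> for \<open>z \<notin> {x, y}\<close> and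
  \<open>[e\<^sub>x\<^sub>y, F x + F y] = 0\<close>. Expanding \<open>\<phi>\<^sup>-\<^sup>1 (e\<^sub>x\<^sub>y)\<close> in weight vectors of the diagonal and reading off
  the \<open>(x, y)\<close> coefficient of the image shows that \<open>F z\<close> and \<open>e\<^sub>z\<close> have the same diagonal up to a
  constant; in particular the type of Lie automorphism that reverses the order is excluded. The
  relations above together with \<open>[F u, F v] = 0\<close> then put the off-diagonal part of \<open>F z\<close> into
  \<open>Z(J)\<close> and make it of the form \<open>[j, e\<^sub>z]\<close>. So \<open>\<phi>\<close> acts on \<open>e\<^sub>x\<^sub>y\<close> by a scalar, which the Hom-Lie
  identity on chains \<open>x < y < z\<close> normalises to \<open>1\<close> off \<open>Min \<times> Max\<close>. Conversely
  \<open>\<xi>\<^sub>\<beta> M\<^sub>\<sigma> f = f + [j, f] + m\<close> with \<open>m \<in> Z(J)\<close>, and \<open>[L, L] \<subseteq> J\<close>, so that the Hom-Lie identity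
  reduces to the Jacobi identity.\<close>

section \<open>Coefficients of commutators\<close>

lemma coef_bas_times: "coef (bas x y * f) p q = (if x \<le> y \<and> p = x then coef f y q else 0)"
proof -
  have "coef (bas x y * f) p q
      = (\<Sum>z\<in>UNIV. if z = y then (if x \<le> y \<and> p = x then coef f y q else 0) else 0)"
    unfolding coef_times_UNIV by (rule sum.cong) (auto simp: bas.rep_eq)
  then show ?thesis by simp
qed

lemma coef_times_bas: "coef (f * bas x y) p q = (if x \<le> y \<and> q = y then coef f p x else 0)"
proof -
  have "coef (f * bas x y) p q
      = (\<Sum>z\<in>UNIV. if z = x then (if x \<le> y \<and> q = y then coef f p x else 0) else 0)"
    unfolding coef_times_UNIV by (rule sum.cong) (auto simp: bas.rep_eq)
  then show ?thesis by simp
qed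

lemma coef_commutator_bas:
  "coef (commutator (bas x y) f) p q =
     (if x \<le> y \<and> p = x then coef f y q else 0) - (if x \<le> y \<and> q = y then coef f p x else 0)"
  "coef (commutator f (bas x y)) p q =
     (if x \<le> y \<and> q = y then coef f p x else 0) - (if x \<le> y \<and> p = x then coef f y q else 0)"
  by (simp_all add: commutator_def coef_simps coef_bas_times coef_times_bas)

lemma commutator_bas_bas:
  assumes "x \<le> y" "u \<le> v"
  shows "commutator (bas x y) (bas u v) = (if y = u then bas x v else 0) - (if v = x then bas u y else 0)"
  using assms by (simp add: commutator_def bas_times_bas)

lemma coef_commutator_diag: "coef (commutator f g) x x = 0"
  by (simp add: commutator_def coef_simps coef_times_diag)

lemma commutator_in_J: "commutator f g \<in> J"
  by (simp add: J_iff coef_commutator_diag)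

text \<open>When the interior points of the interval contribute nothing, only the endpoints survive
  in both product sums. The later weight computations with \<open>F z\<close> rest on this
  formula.\<close>

lemma coef_commutator_no_middle:
  assumes "p < q"
    and "\<And>w. p < w \<Longrightarrow> w < q \<Longrightarrow> coef f p w * coef g w q = 0"
    and "\<And>w. p < w \<Longrightarrow> w < q \<Longrightarrow> coef g p w * coef f w q = 0"
  shows "coef (commutator f g) p q =
    (coef f p p - coef f q q) * coef g p q - (coef g p p - coef g q q) * coef f p q"
proof -
  have *: "coef (f' * g') p q = coef f' p p * coef g' p q + coef f' p q * coef g' q q"
    if "\<And>w. p < w \<Longrightarrow> w < q \<Longrightarrow> coef f' p w * coef g' w q = 0" for f' g' :: "('a, 'b) incidence"
  proof -
    have "coef (f' * g') p q = (\<Sum>z\<in>{p, q}. coef f' p z * coef g' z q)"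
      unfolding times_incidence.rep_eq
    proof (rule sum.mono_neutral_right)
      show "\<forall>i\<in>{p..q} - {p, q}. coef f' p i * coef g' i q = 0"
        using that by auto (metis order_le_less)
    qed (use assms(1) in auto)
    then show ?thesis using assms(1) by simp
  qed
  show ?thesis
    using assms by (simp add: commutator_def coef_simps * algebra_simps)
qed

lemma linear_mult_aut:
  "Vector_Spaces.linear (*\<^sub>K) (*\<^sub>K) (mult_aut (\<sigma> :: ('a::{finite,order}, 'k::field) incidence))"
  by unfold_locales (auto intro!: incidence_eqI simp: mult_aut.rep_eq coef_simps algebra_simps)


section \<open>Centers\<close>

lemma coef_center_of_UNIV:
  assumes "f \<in> center_of UNIV" "x \<noteq> y"
  shows "coef f x y = 0"
proof -
  have "coef (f * bas x x) x y = coef (bas x x * f) x y"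
    using assms by (simp add: center_of_def)
  then show ?thesis using assms(2) by (simp add: coef_times_bas coef_bas_times)
qed

lemma scalar_in_center: "c *\<^sub>K 1 \<in> center_of UNIV"
  by (simp add: center_of_def scaleK_times)

lemma commutator_center: "f \<in> center_of UNIV \<Longrightarrow> commutator g f = 0"
  by (simp add: center_of_def commutator_def)

lemma commutator_center_J: "f \<in> center_of J \<Longrightarrow> g \<in> J \<Longrightarrow> commutator f g = 0"
  by (simp add: center_of_def commutator_def)

text \<open>If t < x, then e_tx f has the entry f(x,y) at (t,y), where f e_tx has none; dually above
  y. Conversely such an f annihilates \<open>J\<close> on both sides, since a nonzero product would
  go below a minimal or above a maximal element.\<close>

lemma center_of_J_iff:
  "f \<in> center_of J \<longleftrightarrow> (\<forall>x y. coef f x y \<noteq> 0 \<longrightarrow> x < y \<and> x \<in> Min_elems \<and> y \<in> Max_elems)"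
proof (intro iffI allI impI)
  fix x y assume f: "f \<in> center_of J" and nz: "coef f x y \<noteq> 0"
  have diag: "coef f z z = 0" for z using f by (simp add: center_of_def J_iff)
  have "x < y" using nz diag coef_eq_0[of x y f] by (auto simp: order.strict_iff_order)
  have comm: "coef (f * bas u v) p q = coef (bas u v * f) p q" if "u < v" for u v p q
  proof -
    have "(bas u v :: ('a, 'b) incidence) \<in> J" using that by (auto simp: J_iff bas.rep_eq)
    then show ?thesis using f by (simp add: center_of_def)
  qed
  have "x \<in> Min_elems"
    unfolding Min_elems_def
  proof safe
    fix t assume "t < x"
    with comm[of t x t y] nz \<open>x < y\<close> show False
      by (auto simp: coef_times_bas coef_bas_times less_imp_le split: if_splits)
  qed
  moreover have "y \<in> Max_elems"
    unfolding Max_elems_def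
  proof safe
    fix t assume "y < t"
    with comm[of y t x t] nz \<open>x < y\<close> show False by (auto simp: coef_times_bas coef_bas_times split: if_splits)
  qed
  ultimately show "x < y \<and> x \<in> Min_elems \<and> y \<in> Max_elems" using \<open>x < y\<close> by simp
next
  assume f: "\<forall>x y. coef f x y \<noteq> 0 \<longrightarrow> x < y \<and> x \<in> Min_elems \<and> y \<in> Max_elems"
  have "f * g = 0 \<and> g * f = 0" if g: "g \<in> J" for g
  proof -
    have "coef f x z * coef g z y = 0" "coef g x z * coef f z y = 0" for x y z
    proof -
      have le: "u < v" if "coef g u v \<noteq> 0" for u v
        using that g coef_eq_0[of u v g] by (auto simp: order.strict_iff_order J_iff)
      show "coef f x z * coef g z y = 0" "coef g x z * coef f z y = 0"
        using f le unfolding Min_elems_def Max_elems_def by fastforce+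
    qed
    then show ?thesis
      by (auto intro!: incidence_eqI simp: coef_times_UNIV coef_simps simp del: mult_eq_0_iff)
  qed
  moreover have "f \<in> J" using f by (auto simp: J_iff)
  ultimately show "f \<in> center_of J" by (simp add: center_of_def)
qed

text \<open>A nonzero term needs x < u <= v < y with u maximal and v minimal. Then u = v, which
  contradicts x < v. Here \<open>f\<close> may have a diagonal; \<open>f = 1\<close> yields j j =
  0.\<close>

lemma center_of_J_sandwich:
  assumes "j \<in> center_of J"
  shows "j * f * j = 0"
proof (rule incidence_eqI)
  fix x y
  have "coef j x u * coef f u v * coef j v y = 0" for u v
    using assms coef_eq_0[of u v f] unfolding center_of_J_iff Min_elems_def Max_elems_def
    by (metis (no_types, lifting) mem_Collect_eq mult_eq_0_iff order_le_less)
  then show "coef (j * f * j) x y = coef 0 x y"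
    by (simp add: coef_times_UNIV sum_distrib_right coef_simps del: mult_eq_0_iff)
qed

section \<open>Unipotent conjugation and sufficiency of the decomposition\<close>

lemma unit_inv_unique:
  assumes "b * c = 1" "c * b = (1 :: 'r::ring_1)"
  shows "ring_unit b" "unit_inv b = c"
proof -
  show "ring_unit b" using assms unfolding ring_unit_def by blast
  from unit_inv(2)[OF this] have "unit_inv b * b * c = c" by simp
  then show "unit_inv b = c" using assms(1) by (simp add: mult.assoc)
qed

text \<open>As j squares to 0, the inverse of 1 + j is 1 - j, and the quadratic term j f j of the
  conjugation vanishes by \<open>center_of_J_sandwich\<close>.\<close>

lemma unipotent_central:
  assumes "j \<in> center_of J"
  shows "ring_unit (1 + j)" and "\<xi> (1 + j) f = f + commutator j f"
proof -
  have "j * j = 0" using center_of_J_sandwich[OF assms, of 1] by simp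
  then have inv: "(1 + j) * (1 - j) = 1" "(1 - j) * (1 + j) = 1"
    by (simp_all add: algebra_simps)
  show "ring_unit (1 + j)" using inv by (rule unit_inv_unique)
  show "\<xi> (1 + j) f = f + commutator j f"
    unfolding inner_aut_def unit_inv_unique(2)[OF inv]
    using center_of_J_sandwich[OF assms, of f] by (simp add: commutator_def algebra_simps)
qed

lemma admissible_beta_part_J:
  assumes "admissible_beta \<beta>"
  shows "part_J \<beta> \<in> center_of J" "\<beta> = 1 + part_J \<beta>"
  using assms part_D_part_J(1)[of \<beta>] by (simp_all add: admissible_beta_def)

lemma admissible_beta_unipotent:
  assumes "j \<in> center_of J"
  shows "admissible_beta (1 + j)"
proof -
  have "j \<in> J" using assms by (simp add: center_of_def)
  have "(1 :: ('a, 'b) incidence) \<in> D" by (simp add: D_iff coef_simps)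
  from part_D_part_J_unique[OF refl this \<open>j \<in> J\<close>] show ?thesis
    using assms unipotent_central(1)[OF assms] by (simp add: admissible_beta_def)
qed

lemma multiplicative_diag:
  assumes "multiplicative \<sigma>"
  shows "coef \<sigma> x x = 1"
proof -
  have "coef \<sigma> x x \<noteq> 0" "coef \<sigma> x x = coef \<sigma> x x * coef \<sigma> x x"
    using assms unfolding multiplicative_def by blast+
  then show ?thesis by simp
qed

lemma mult_aut_minus_in_center:
  assumes "admissible_sigma \<sigma>"
  shows "mult_aut \<sigma> f - f \<in> center_of J"
  unfolding center_of_J_iff
proof (intro allI impI)
  fix x y assume nz: "coef (mult_aut \<sigma> f - f) x y \<noteq> 0"
  then have "coef \<sigma> x y \<noteq> 1" "coef f x y \<noteq> 0" by (auto simp: mult_aut.rep_eq coef_simps)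
  then show "x < y \<and> x \<in> Min_elems \<and> y \<in> Max_elems"
    using assms multiplicative_diag[of \<sigma> x] coef_eq_0[of x y f] unfolding admissible_sigma_def
    by (metis order_le_less)
qed

text \<open>The change made by \<open>mult_aut \<sigma>\<close> lies in Z(J), so it commutes with j,
  and the two factors contribute separate summands.\<close>

lemma inner_mult_aut:
  assumes "j \<in> center_of J" "admissible_sigma \<sigma>"
  shows "(\<xi> (1 + j) \<circ> mult_aut \<sigma>) f = mult_aut \<sigma> f + commutator j f"
proof -
  have "commutator j (mult_aut \<sigma> f) = commutator j (mult_aut \<sigma> f - f) + commutator j f"
    by (simp flip: incidence.bracket_add_right)
  moreover have "mult_aut \<sigma> f - f \<in> J"
    using mult_aut_minus_in_center[OF assms(2)] by (simp add: center_of_def)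
  then have "commutator j (mult_aut \<sigma> f - f) = 0"
    by (rule commutator_center_J[OF assms(1)])
  ultimately show ?thesis by (simp add: unipotent_central(2)[OF assms(1)])
qed

lemma regular_hom_lie_inner_mult_aut:
  assumes "incidence.lie_automorphism \<phi>"
    and "admissible_beta \<beta>" "admissible_sigma \<sigma>" "admissible_nu \<nu>"
    and \<phi>: "\<phi> = (\<lambda>f. (\<xi> \<beta> \<circ> mult_aut \<sigma>) f + \<nu> f)"
  shows "incidence.regular_hom_lie \<phi>"
proof -
  define j where "j = part_J \<beta>"
  have j: "j \<in> center_of J" "\<beta> = 1 + j"
    using admissible_beta_part_J[OF assms(2)] by (simp_all add: j_def)
  have key: "commutator (commutator a b) (\<phi> c) = commutator (commutator a b) c" for a b c
  proof -
    let ?h = "commutator a b"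
    have "\<phi> c = c + (mult_aut \<sigma> c - c) + commutator j c + \<nu> c"
      using inner_mult_aut[OF j(1) assms(3), of c] by (simp add: \<phi> j(2))
    moreover have "commutator ?h (mult_aut \<sigma> c - c) = 0"
      using mult_aut_minus_in_center[OF assms(3), of c] commutator_in_J[of a b]
      by (simp add: center_of_def commutator_def)
    moreover have "commutator ?h (commutator j c) = 0"
    proof -
      \<comment> \<open>The derivation form of the Jacobi identity brings j next to elements of
        \<open>J\<close>, with which it commutes.\<close>
      have "commutator ?h (commutator j c)
          = commutator (commutator ?h j) c + commutator j (commutator ?h c)"
        by (simp add: commutator_def algebra_simps)
      moreover have "commutator ?h j = - commutator j ?h"
        by (simp add: commutator_def)
      moreover have "commutator j ?h = 0" "commutator j (commutator ?h c) = 0"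
        by (rule commutator_center_J[OF j(1) commutator_in_J])+
      ultimately show ?thesis by (simp add: commutator_def[of 0])
    qed
    moreover have "commutator ?h (\<nu> c) = 0"
      using assms(4) by (intro commutator_center) (auto simp: admissible_nu_def)
    ultimately show ?thesis by (simp only: incidence.bracket_add_right add_0_right)
  qed
  show ?thesis
    unfolding incidence.regular_hom_lie_def
    using assms(1) by (simp add: key incidence.jacobi)
qed

section \<open>Uniqueness of the parameters\<close>

lemma parameters_unique:
  assumes "admissible_beta \<beta>" "admissible_sigma \<sigma>" "admissible_nu \<nu>"
    and "\<phi> = (\<lambda>f. (\<xi> \<beta> \<circ> mult_aut \<sigma>) f + \<nu> f)"
    and "admissible_beta \<beta>'" "admissible_sigma \<sigma>'" "admissible_nu \<nu>'"
    and "\<phi> = (\<lambda>f. (\<xi> \<beta>' \<circ> mult_aut \<sigma>') f + \<nu>' f)"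
  shows "\<beta> = \<beta>' \<and> \<sigma> = \<sigma>' \<and> \<nu> = \<nu>'"
proof -
  \<comment> \<open>Central values have no off-diagonal entries, so \<nu> does not disturb these
    coefficients. They determine \<beta> and \<sigma>, and \<nu> is then the remainder.\<close>
  have rec: "coef (part_J \<beta>) x y = coef (\<phi> (bas y y)) x y" "coef \<sigma> x y = coef (\<phi> (bas x y)) x y"
    if "admissible_beta \<beta>" "admissible_sigma \<sigma>" "admissible_nu \<nu>"
      "\<phi> = (\<lambda>f. (\<xi> \<beta> \<circ> mult_aut \<sigma>) f + \<nu> f)" "x < y"
    for \<beta> \<sigma> :: "('a, 'b) incidence" and \<nu> \<phi> and x y :: 'a
  proof -
    note j = admissible_beta_part_J[OF that(1)]
    have \<phi>: "\<phi> f = mult_aut \<sigma> f + commutator (part_J \<beta>) f + \<nu> f" for f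
      using inner_mult_aut[OF j(1) that(2), of f] j(2) that(4) by simp
    have \<nu>: "coef (\<nu> f) x y = 0" for f
      using that by (intro coef_center_of_UNIV) (auto simp: admissible_nu_def)
    show "coef (part_J \<beta>) x y = coef (\<phi> (bas y y)) x y" "coef \<sigma> x y = coef (\<phi> (bas x y)) x y"
      using \<open>x < y\<close> by (auto simp: \<phi> \<nu> coef_simps mult_aut.rep_eq coef_commutator_bas bas.rep_eq part_J.rep_eq)
  qed
  have "part_J \<beta> = part_J \<beta>'"
  proof (rule incidence_eqI)
    fix x y :: 'a assume "x \<le> y"
    then show "coef (part_J \<beta>) x y = coef (part_J \<beta>') x y"
      using rec(1)[OF assms(1-4)] rec(1)[OF assms(5-8)]
      by (cases "x = y") (simp_all add: part_J.rep_eq order.strict_iff_order)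
  qed
  then have "\<beta> = \<beta>'"
    using admissible_beta_part_J(2)[OF assms(1)] admissible_beta_part_J(2)[OF assms(5)] by simp
  moreover have "\<sigma> = \<sigma>'"
  proof (rule incidence_eqI)
    fix x y :: 'a assume "x \<le> y"
    moreover have "coef \<sigma> x x = coef \<sigma>' x x"
      using assms(2,6) by (simp add: admissible_sigma_def multiplicative_diag)
    ultimately show "coef \<sigma> x y = coef \<sigma>' x y"
      using rec(2)[OF assms(1-4)] rec(2)[OF assms(5-8)]
      by (cases "x = y") (simp_all add: order.strict_iff_order)
  qed
  moreover have "\<nu> f = \<nu>' f" for f
    using fun_cong[OF assms(4), of f] fun_cong[OF assms(8), of f]
      \<open>\<beta> = \<beta>'\<close> \<open>\<sigma> = \<sigma>'\<close> by simp
  ultimately show ?thesis by auto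
qed


section \<open>Regular Hom-Lie structures\<close>

locale regular_hom_lie_incidence =
  fixes \<phi> :: "('a::{finite,order}, 'k::field) incidence \<Rightarrow> ('a, 'k) incidence"
  assumes connected: "connected_poset TYPE('a)"
    and regular: "incidence.regular_hom_lie \<phi>"
begin

abbreviation F :: "'a \<Rightarrow> ('a, 'k) incidence" where
  "F z \<equiv> \<phi> (bas z z)"

section \<open>Relations for the images of the idempotents, and their diagonals\<close>

lemma linear_phi: "Vector_Spaces.linear (*\<^sub>K) (*\<^sub>K) \<phi>"
  and bij_phi: "bij \<phi>"
  and phi_commutator: "\<phi> (commutator a b) = commutator (\<phi> a) (\<phi> b)"
  and hom_lie: "commutator (commutator a b) (\<phi> c) + commutator (commutator b c) (\<phi> a)
            + commutator (commutator c a) (\<phi> b) = 0"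
  using regular unfolding incidence.regular_hom_lie_def incidence.lie_automorphism_def by blast+

sublocale phi: Vector_Spaces.linear "(*\<^sub>K)" "(*\<^sub>K)" \<phi>
  by (rule linear_phi)

text \<open>In the triples (e_x, e_xy, e_z) and (e_x, e_xy, e_y) every inner bracket is 0 or e_xy,
  so the Hom-Lie identity involves only the brackets of e_xy with values of
  \<open>F\<close>.\<close>

lemma commutator_F:
  assumes "x < y"
  shows "z \<noteq> x \<Longrightarrow> z \<noteq> y \<Longrightarrow> commutator (bas x y) (F z) = 0"
    and "commutator (bas x y) (F x) + commutator (bas x y) (F y) = 0"
proof -
  have "x \<le> y" "x \<noteq> y" using assms by auto
  show "commutator (bas x y) (F z) = 0" if "z \<noteq> x" "z \<noteq> y"
    using hom_lie[of "bas x x" "bas x y" "bas z z"] that \<open>x \<le> y\<close> \<open>x \<noteq> y\<close>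
    by (simp add: commutator_bas_bas incidence.bracket_self) (simp add: commutator_def)
  show "commutator (bas x y) (F x) + commutator (bas x y) (F y) = 0"
    using hom_lie[of "bas x x" "bas x y" "bas y y"] \<open>x \<le> y\<close> \<open>x \<noteq> y\<close>
    by (simp add: commutator_bas_bas commutator_def[of 0] add.commute)
qed

lemma F_diag_const:
  assumes "x < y" "z \<noteq> x" "z \<noteq> y"
  shows "coef (F z) x x = coef (F z) y y"
  using arg_cong[OF commutator_F(1)[OF assms], of "\<lambda>f. coef f x y"] less_imp_le[OF assms(1)] assms
  by (simp add: coef_commutator_bas coef_simps)

text \<open>Surjectivity of \<phi> enters here: the weight components of the preimage of e_xy have
  images whose (x,y) coefficients must add up to 1. Only the component at (x,y) can contribute, so
  \<phi>(e_xy) has a nonzero (x,y) coefficient up to scaling, and its weight under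
  \<open>F x\<close> fixes the sign.\<close>

lemma F_diag_edge:
  assumes "x < y"
  shows "coef (F x) x x - coef (F x) y y = 1" "coef (F y) x x - coef (F y) y y = -1"
proof -
  \<comment> \<open>\<open>I\<close> is the ideal generated by \<open>bas x y\<close>; \<open>ad (F u)\<close> acts on its top coefficient by \<open>\<alpha> u\<close>.\<close>
  define I where "I h \<longleftrightarrow> (\<forall>p q. coef h p q \<noteq> 0 \<longrightarrow> p \<le> x \<and> y \<le> q)" for h :: "('a, 'k) incidence"
  have I_zero: "coef h p q = 0" if "I h" "\<not> p \<le> x \<or> \<not> y \<le> q" for h p q
    using that unfolding I_def by blast
  have I_comm: "I (commutator f h)" if "I h" for f h
    unfolding I_def
  proof (intro allI impI, rule ccontr)
    fix p q assume nz: "coef (commutator f h) p q \<noteq> 0" and pq: "\<not> (p \<le> x \<and> y \<le> q)"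
    have "coef f p w = 0 \<or> coef h w q = 0" "coef h p w = 0 \<or> coef f w q = 0" for w
      using I_zero[OF that, of w q] I_zero[OF that, of p w] coef_eq_0[of p w f] coef_eq_0[of w q f] pq
      by (blast intro: order_trans)+
    then have "coef (f * h) p q = 0" "coef (h * f) p q = 0"
      unfolding coef_times_UNIV by (auto intro!: sum.neutral)
    then show False using nz by (simp add: commutator_def coef_simps)
  qed
  have coef_comm: "coef (commutator f h) x y = (coef f x x - coef f y y) * coef h x y"
    if "I h" for f h
  proof -
    have h0: "coef h p q = 0" if "x < p \<or> q < y" for p q
      using that by (intro I_zero[OF \<open>I h\<close>]) (auto simp: less_le_not_le)
    show ?thesis
      using coef_commutator_no_middle[OF assms, of f h] assms by (simp add: h0)
  qed
  have skew: "commutator f h = - commutator h f" for f h :: "('a, 'k) incidence"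
    by (simp add: commutator_def)
  define \<alpha> where "\<alpha> z = coef (F z) x x - coef (F z) y y" for z
  have \<alpha>0: "\<alpha> z = 0" if "z \<noteq> x" "z \<noteq> y" for z
    using F_diag_const[OF assms that] by (simp add: \<alpha>_def)
  have I_bas: "I (bas x y)" unfolding I_def by (auto simp: bas.rep_eq)
  \<comment> \<open>\<open>H u v\<close> will be the image of the component of g at (u,v), expressed
    through \<open>F\<close> and e_xy alone.\<close>
  define H where "H u v = commutator (F u) (commutator (bas x y) (F v))" for u v
  have I_H: "I (H u v)" and coef_H: "coef (H u v) x y = - \<alpha> u * \<alpha> v" for u v
  proof -
    have *: "I (commutator (bas x y) (F v))"
      using I_comm[OF I_bas, of "F v"] unfolding skew[of "bas x y"] by (simp add: I_def coef_simps)
    then show "I (H u v)" unfolding H_def by (rule I_comm)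
    show "coef (H u v) x y = - \<alpha> u * \<alpha> v"
      unfolding H_def coef_comm[OF *] \<alpha>_def unfolding skew[of "bas x y"]
      using less_imp_le[OF assms] by (simp add: coef_comm[OF I_bas] coef_simps bas.rep_eq algebra_simps)
  qed
  obtain g where g: "\<phi> g = bas x y" using bij_phi by (metis bij_is_surj surjD)
  \<comment> \<open>Since e_xy = [e_x, e_xy], its preimage is a commutator too.\<close>
  have g_diag: "coef g p p = 0" for p
  proof -
    obtain f where f: "\<phi> f = bas x x" using bij_phi by (metis bij_is_surj surjD)
    have "\<phi> (commutator f g) = \<phi> g"
      using assms by (auto simp: phi_commutator f g commutator_bas_bas)
    then have "commutator f g = g" using bij_phi by (simp add: bij_is_inj inj_eq)
    then show ?thesis using coef_commutator_diag by metis
  qed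
  \<comment> \<open>Bracketing with e_u and e_v isolates one entry of g; the mirrored entry g(v,u)
    vanishes because u < v.\<close>
  have phi_component: "\<phi> (coef g u v *\<^sub>K bas u v) = H u v" if "u < v" for u v
  proof -
    have "commutator (bas u u) (commutator g (bas v v)) = coef g u v *\<^sub>K bas u v"
      using that coef_eq_0[of v u g]
      by (intro incidence_eqI) (auto simp: coef_commutator_bas coef_simps bas.rep_eq)
    then show ?thesis by (simp add: H_def flip: g phi_commutator)
  qed
  have "bas x y = \<phi> (\<Sum>(u, v)\<in>{(u, v). u < v}. coef g u v *\<^sub>K bas u v)"
  proof -
    have less: "(\<Sum>(u, v)\<in>{(u, v). u \<le> v}. coef g u v *\<^sub>K bas u v)
        = (\<Sum>(u, v)\<in>{(u, v). u < v}. coef g u v *\<^sub>K bas u v)"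
      by (rule sum.mono_neutral_right) (auto simp: g_diag order.strict_iff_order)
    from incidence_expansion[of g]
    have "\<phi> g = \<phi> (\<Sum>(u, v)\<in>{(u, v). u < v}. coef g u v *\<^sub>K bas u v)"
      unfolding less by (rule arg_cong)
    then show ?thesis unfolding g .
  qed
  also have "\<dots> = (\<Sum>(u, v)\<in>{(u, v). u < v}. H u v)"
    unfolding phi.sum by (rule sum.cong) (auto simp: phi_component)
  finally have "coef (bas x y :: ('a, 'k) incidence) x y
      = (\<Sum>(u, v)\<in>{(u, v). u < v}. - \<alpha> u * \<alpha> v)"
    by (simp add: coef_sum coef_H split_beta)
  \<comment> \<open>The factor \<alpha> vanishes off x and y, and the pair (y,x) is not in the index
    set.\<close>
  also have "\<dots> = (\<Sum>(u, v)\<in>{(x, y)}. - \<alpha> u * \<alpha> v)"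
  proof (rule sum.mono_neutral_right)
    have "- \<alpha> u * \<alpha> v = 0" if "u < v" "(u, v) \<noteq> (x, y)" for u v
    proof -
      have "u \<noteq> x \<and> u \<noteq> y \<or> v \<noteq> x \<and> v \<noteq> y" using that assms by (auto dest: less_asym)
      then show ?thesis using \<alpha>0 by auto
    qed
    then show "\<forall>i\<in>{(u, v). u < v} - {(x, y)}. (case i of (u, v) \<Rightarrow> - \<alpha> u * \<alpha> v) = 0"
      by fast
  qed (use assms in auto)
  finally have prod: "- \<alpha> x * \<alpha> y = 1"
    using less_imp_le[OF assms] by (simp add: bas.rep_eq)
  \<comment> \<open>\<open>H x y\<close> is a multiple of \<phi>(e_xy), hence fixed by bracketing
    with \<open>F x\<close>. By \<open>prod\<close> its (x,y) coefficient is 1, so the eigenvalue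
    \<alpha> x can be read off.\<close>
  have "commutator (F x) (H x y) = H x y"
    unfolding phi_component[OF assms, symmetric] phi_commutator[symmetric]
    using less_imp_le[OF assms] less_imp_neq[OF assms]
    by (simp add: incidence.bracket_scale_right commutator_bas_bas)
  then have "\<alpha> x = 1"
    using coef_comm[OF I_H[of x y], of "F x"] prod by (auto simp: coef_H simp flip: \<alpha>_def)
  moreover from this prod have "- \<alpha> y = 1" by simp
  then have "\<alpha> y = - 1" using minus_minus by metis
  ultimately show "coef (F x) x x - coef (F x) y y = 1" "coef (F y) x x - coef (F y) y y = -1"
    by (simp_all only: \<alpha>_def)
qed

lemma F_diag_diff:
  assumes "p < q"
  shows "coef (F z) p p - coef (F z) q q = (if z = p then 1 else 0) - (if z = q then 1 else 0)"
  using F_diag_edge[OF assms] F_diag_const[OF assms, of z] assms by auto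

text \<open>The defect against the diagonal of e_z is constant along comparable pairs; connectedness
  spreads it over the whole poset.\<close>

lemma F_diag:
  obtains c where "\<And>p. coef (F z) p p = (if z = p then 1 else 0) + c"
proof
  define d where "d p = coef (F z) p p - (if z = p then 1 else 0)" for p
  have step: "d u = d v" if "u \<le> v" for u v
    using F_diag_diff[of u v z] that by (cases "u = v") (auto simp: d_def algebra_simps order.strict_iff_order split: if_splits)
  have "d p = d q" if "(\<lambda>u v. u \<le> v \<or> v \<le> u)\<^sup>*\<^sup>* p q" for p q
    using that by (induction rule: rtranclp_induct) (metis step)+
  then have "d p = d z" for p using connected unfolding connected_poset_def by blast
  then show "coef (F z) p p = (if z = p then 1 else 0) + d z" for p
    by (metis d_def add.commute diff_add_cancel)
qed

section \<open>Off-diagonal entries of the images of the idempotents\<close>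

lemma commutator_F_F: "commutator (F u) (F v) = 0"
proof -
  have "commutator (bas u u) (bas v v) = (0 :: ('a, 'k) incidence)"
    by (simp add: commutator_bas_bas)
  then show ?thesis using phi_commutator phi.zero by metis
qed

text \<open>The edge t < p carries the entry at (p,q) to (t,q), so \<open>commutator_F\<close> kills
  it for z other than t and p. For these two it only gives a vanishing sum; [F t, F p] = 0 at (p,q)
  then kills the summand for t.\<close>

lemma F_row:
  assumes "t < p" "p < q"
  shows "coef (F z) p q = 0"
proof -
  have t0: "coef (F z) u v = 0" if "s < u" "u < v" "z \<noteq> s" "z \<noteq> u" for s u v z
    using arg_cong[OF commutator_F(1)[OF that(1,3,4)], of "\<lambda>f. coef f s v"] that less_imp_le[OF that(1)]
    by (auto simp: coef_commutator_bas coef_simps)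
  have "t < q" using assms by simp
  have "coef (commutator (F t) (F p)) p q = - coef (F t) p q"
  proof (subst coef_commutator_no_middle[OF assms(2)])
    fix w assume w: "p < w" "w < q"
    show "coef (F t) p w * coef (F p) w q = 0"
      using t0[of t w q p] w assms by auto
    show "coef (F p) p w * coef (F t) w q = 0"
      using t0[of p w q t] w assms by auto
  qed (use assms \<open>t < q\<close> in \<open>auto simp: F_diag_diff\<close>)
  then have "coef (F t) p q = 0" by (simp add: commutator_F_F coef_simps)
  moreover have "coef (F t) p q + coef (F p) p q = 0"
    using arg_cong[OF commutator_F(2)[OF assms(1)], of "\<lambda>f. coef f t q"] assms
      less_imp_le[OF assms(1)] less_imp_neq[OF assms(2)]
    by (auto simp: coef_commutator_bas coef_simps algebra_simps neg_eq_iff_add_eq_0)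
  ultimately show ?thesis using t0[OF assms, of z] by auto
qed

text \<open>The order dual of \<open>F_row\<close>, with the edge q < t moving (p,q) to
  (p,t).\<close>

lemma F_column:
  assumes "p < q" "q < t"
  shows "coef (F z) p q = 0"
proof -
  have t0: "coef (F z) u v = 0" if "v < s" "u < v" "z \<noteq> v" "z \<noteq> s" for s u v z
    using arg_cong[OF commutator_F(1)[OF that(1,3,4)], of "\<lambda>f. coef f u s"] that
      less_imp_le[OF that(1)] less_imp_neq[OF that(2)]
    by (auto simp: coef_commutator_bas coef_simps)
  have "p < t" using assms by simp
  have "coef (commutator (F t) (F q)) p q = coef (F t) p q"
  proof (subst coef_commutator_no_middle[OF assms(1)])
    fix w assume w: "p < w" "w < q"
    show "coef (F t) p w * coef (F q) w q = 0"
      using t0[of w q p t] w assms by auto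
    show "coef (F q) p w * coef (F t) w q = 0"
      using t0[of w t p q] w assms by auto
  qed (use assms \<open>p < t\<close> in \<open>auto simp: F_diag_diff\<close>)
  then have "coef (F t) p q = 0" by (simp add: commutator_F_F coef_simps)
  moreover have "coef (F q) p q + coef (F t) p q = 0"
    using arg_cong[OF commutator_F(2)[OF assms(2)], of "\<lambda>f. coef f p t"] assms
      less_imp_le[OF assms(2)] less_imp_neq[OF assms(1)]
    by (auto simp: coef_commutator_bas coef_simps algebra_simps neg_eq_iff_add_eq_0)
  ultimately show ?thesis using t0[OF assms(2,1), of z] by auto
qed

lemma F_min_max:
  assumes "p < q" "coef (F z) p q \<noteq> 0"
  shows "p \<in> Min_elems" "q \<in> Max_elems"
  using F_row[of _ p q z] F_column[of p q _ z] assms unfolding Min_elems_def Max_elems_def by auto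

text \<open>Read [F u, F v] = 0 at (p,q), where rows and columns already remove the interior terms.
  The result is the off-diagonal shape of [j, e_z] with j(p,q) the (p,q) entry of
  \<open>F q\<close>.\<close>

lemma F_off_diag:
  assumes "p < q"
  shows "z \<noteq> p \<Longrightarrow> z \<noteq> q \<Longrightarrow> coef (F z) p q = 0" and "coef (F p) p q = - coef (F q) p q"
proof -
  have *: "(coef (F u) p p - coef (F u) q q) * coef (F v) p q
      = (coef (F v) p p - coef (F v) q q) * coef (F u) p q" for u v
    using coef_commutator_no_middle[OF assms, of "F u" "F v"] F_row[of p _ q] F_column[of p _ q]
    by (simp add: commutator_F_F coef_simps)
  show "coef (F z) p q = 0" if "z \<noteq> p" "z \<noteq> q"
    using *[of p z] that less_imp_neq[OF assms] by (simp add: F_diag_diff[OF assms])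
  show "coef (F p) p q = - coef (F q) p q"
    using *[of p q] less_imp_neq[OF assms] by (simp add: F_diag_diff[OF assms])
qed

section \<open>The scalars by which \<phi> acts on the radical basis\<close>

definition s :: "'a \<Rightarrow> 'a \<Rightarrow> 'k" where
  "s x y = coef (\<phi> (bas x y)) x y"

text \<open>The image of e_xy is a weight vector for both \<open>F x\<close> and \<open>F y\<close>,
  and (x,y) is the only position with both required weights.\<close>

lemma phi_bas:
  assumes "x < y"
  shows "\<phi> (bas x y) = s x y *\<^sub>K bas x y"
proof (rule incidence_eqI)
  let ?h = "\<phi> (bas x y)"
  have eq: "?h = commutator (F x) ?h" "?h = commutator ?h (F y)"
    using less_imp_le[OF assms] less_imp_neq[OF assms]
    by (simp_all add: commutator_bas_bas flip: phi_commutator)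
  fix p q :: 'a assume "p \<le> q"
  show "coef ?h p q = coef (s x y *\<^sub>K bas x y) p q"
  proof (cases "p = q")
    case True
    then show ?thesis
      using coef_commutator_diag[of "F x" ?h p] eq(1) assms by (auto simp: coef_simps bas.rep_eq)
  next
    case False
    with \<open>p \<le> q\<close> have "p < q" by simp
    have diag: "coef ?h r r = 0" for r using coef_commutator_diag eq(1) by metis
    have "coef ?h p q = (coef (F x) p p - coef (F x) q q) * coef ?h p q"
      using coef_commutator_no_middle[OF \<open>p < q\<close>, of "F x" ?h] F_row[of p _ q] F_column[of p _ q] eq(1)
      by (simp add: diag)
    moreover have "coef ?h p q = - (coef (F y) p p - coef (F y) q q) * coef ?h p q"
      using coef_commutator_no_middle[OF \<open>p < q\<close>, of ?h "F y"] F_row[of p _ q] F_column[of p _ q] eq(2)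
      by (simp add: diag algebra_simps)
    \<comment> \<open>In characteristic 2, where 1 = -1, each equation alone would also admit q = x
      or p = y; together with p < q and x < y only (x,y) is left.\<close>
    ultimately have "coef ?h p q = 0 \<or> (p = x \<and> q = y)"
      using assms \<open>p < q\<close> by (auto simp: F_diag_diff split: if_splits)
    then show ?thesis
      using assms by (auto simp: coef_simps bas.rep_eq s_def)
  qed
qed

lemma s_nonzero:
  assumes "x < y"
  shows "s x y \<noteq> 0"
proof
  assume "s x y = 0"
  then have "\<phi> (bas x y) = \<phi> 0" using phi_bas[OF assms] by simp
  then have "bas x y = (0 :: ('a, 'k) incidence)" using bij_phi by (metis bij_pointE)
  then have "coef (bas x y :: ('a, 'k) incidence) x y = 0" by (simp add: coef_simps)
  then show False using less_imp_le[OF assms] by (simp add: bas.rep_eq)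
qed

text \<open>In the Hom-Lie identity for (e_x, e_xy, e_yz), the scalar of e_yz is balanced against
  the diagonal difference 1 of \<open>F x\<close>; the triple (e_z, e_yz, e_xy) treats e_xy
  likewise. Every pair x < y outside Min x Max is an edge of such a chain.\<close>

lemma s_chain:
  assumes "x < y" "y < z"
  shows "s x y = 1" "s y z = 1" "s x z = 1"
proof -
  have "x < z" using assms by simp
  have le: "x \<le> y" "y \<le> z" "x \<le> z" "x \<noteq> y" "y \<noteq> z" "x \<noteq> z" using assms by auto
  have "commutator (bas x y) (\<phi> (bas y z)) + commutator (bas x z) (F x) = 0"
    using hom_lie[of "bas x x" "bas x y" "bas y z"] le
    by (simp add: commutator_bas_bas) (simp add: commutator_def[of 0])
  from arg_cong[OF this, of "\<lambda>f. coef f x z"] F_diag_edge(1)[OF \<open>x < z\<close>] le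
  show 2: "s y z = 1" by (auto simp: coef_commutator_bas coef_simps phi_bas assms bas.rep_eq algebra_simps)
  have "commutator (bas y z) (\<phi> (bas x y)) + commutator (bas x z) (F z) = 0"
    using hom_lie[of "bas z z" "bas y z" "bas x y"] le
    by (simp add: commutator_bas_bas) (simp add: commutator_def algebra_simps)
  from arg_cong[OF this, of "\<lambda>f. coef f x z"] F_diag_edge(2)[OF \<open>x < z\<close>] le
  show 1: "s x y = 1" by (auto simp: coef_commutator_bas coef_simps phi_bas assms bas.rep_eq algebra_simps)
  have "\<phi> (bas x z) = commutator (\<phi> (bas x y)) (\<phi> (bas y z))"
    using le by (simp add: commutator_bas_bas flip: phi_commutator)
  also have "\<dots> = bas x z"
    using le by (simp add: phi_bas assms 1 2 commutator_bas_bas)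
  finally show "s x z = 1" using le by (simp add: s_def bas.rep_eq)
qed

section \<open>Construction of the parameters\<close>

lift_definition \<sigma>\<^sub>0 :: "('a, 'k) incidence" is
  "\<lambda>x y. if x = y then 1 else if x < y then s x y else 0" by auto

text \<open>The entries are those that the uniqueness argument reads off \<phi>.\<close>

lift_definition j\<^sub>0 :: "('a, 'k) incidence" is
  "\<lambda>x y. if x < y then coef (F y) x y else 0" by auto

lemma j0_central: "j\<^sub>0 \<in> center_of J"
  unfolding center_of_J_iff by (auto simp: j\<^sub>0.rep_eq F_min_max split: if_splits)

lemma admissible_sigma0: "admissible_sigma \<sigma>\<^sub>0"
  unfolding admissible_sigma_def multiplicative_def
proof (intro conjI allI impI)
  fix x y :: 'a assume "x \<le> y"
  then show "coef \<sigma>\<^sub>0 x y \<noteq> 0" by (auto simp: \<sigma>\<^sub>0.rep_eq s_nonzero)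
next
  fix x y z :: 'a assume "x \<le> y" "y \<le> z"
  then show "coef \<sigma>\<^sub>0 x z = coef \<sigma>\<^sub>0 x y * coef \<sigma>\<^sub>0 y z"
    using s_chain[of x y z] by (auto simp: \<sigma>\<^sub>0.rep_eq order.order_iff_strict)
next
  fix x y :: 'a assume "x < y" "\<not> (x \<in> Min_elems \<and> y \<in> Max_elems)"
  then show "coef \<sigma>\<^sub>0 x y = 1"
    using s_chain unfolding Min_elems_def Max_elems_def by (auto simp: \<sigma>\<^sub>0.rep_eq)
qed

text \<open>Defined as the remainder, by the formula of \<open>inner_mult_aut\<close>, so that the
  decomposition holds at once and only admissibility needs proof.\<close>

definition \<nu>\<^sub>0 :: "('a, 'k) incidence \<Rightarrow> ('a, 'k) incidence" where
  "\<nu>\<^sub>0 f = \<phi> f - (mult_aut \<sigma>\<^sub>0 f + commutator j\<^sub>0 f)"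

lemma linear_nu0: "Vector_Spaces.linear (*\<^sub>K) (*\<^sub>K) \<nu>\<^sub>0"
proof -
  interpret m: Vector_Spaces.linear "(*\<^sub>K)" "(*\<^sub>K)" "mult_aut \<sigma>\<^sub>0" by (rule linear_mult_aut)
  show ?thesis
    by unfold_locales (simp_all add: \<nu>\<^sub>0_def phi.add phi.scale m.add m.scale incidence.bracket_add_right
        incidence.bracket_scale_right incidence.scale_right_distrib incidence.scale_right_diff_distrib)
qed

lemma nu0_bas_less:
  assumes "x < y"
  shows "\<nu>\<^sub>0 (bas x y) = 0"
proof -
  have "commutator j\<^sub>0 (bas x y) = 0"
    using assms by (intro commutator_center_J[OF j0_central]) (auto simp: J_iff bas.rep_eq)
  moreover have "mult_aut \<sigma>\<^sub>0 (bas x y) = s x y *\<^sub>K bas x y"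
    using assms by (intro incidence_eqI) (auto simp: mult_aut.rep_eq coef_simps bas.rep_eq \<sigma>\<^sub>0.rep_eq)
  ultimately show ?thesis by (simp add: \<nu>\<^sub>0_def phi_bas[OF assms])
qed

text \<open>Off the diagonal, the bracket with \<open>j\<^sub>0\<close> cancels \<open>F z\<close>
  by \<open>F_off_diag\<close>; on it, the constant from \<open>F_diag\<close> remains.\<close>

lemma nu0_bas_diag: "\<nu>\<^sub>0 (bas z z) \<in> center_of UNIV"
proof -
  obtain c where c: "\<And>p. coef (F z) p p = (if z = p then 1 else 0) + c" using F_diag[of z] by metis
  have "\<nu>\<^sub>0 (bas z z) = c *\<^sub>K 1"
  proof (rule incidence_eqI)
    fix p q :: 'a assume "p \<le> q"
    then consider "p = q" | "p < q" by fastforce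
    then show "coef (\<nu>\<^sub>0 (bas z z)) p q = coef (c *\<^sub>K 1) p q"
    proof cases
      case 1
      then show ?thesis
        by (simp add: \<nu>\<^sub>0_def coef_simps c coef_commutator_diag mult_aut.rep_eq \<sigma>\<^sub>0.rep_eq bas.rep_eq)
    next
      case 2
      then show ?thesis
        using F_off_diag[OF 2]
        by (auto simp: \<nu>\<^sub>0_def coef_simps coef_commutator_bas mult_aut.rep_eq \<sigma>\<^sub>0.rep_eq j\<^sub>0.rep_eq bas.rep_eq)
    qed
  qed
  then show ?thesis by (simp add: scalar_in_center)
qed

lemma admissible_nu0: "admissible_nu \<nu>\<^sub>0"
  unfolding admissible_nu_def
proof (intro conjI)
  interpret nu: Vector_Spaces.linear "(*\<^sub>K)" "(*\<^sub>K)" \<nu>\<^sub>0 by (rule linear_nu0)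
  show "Vector_Spaces.linear (*\<^sub>K) (*\<^sub>K) \<nu>\<^sub>0" by (rule linear_nu0)
  have sub: "incidence.subspace (center_of UNIV)"
    by (auto simp: incidence.subspace_def center_of_def scaleK_times algebra_simps)
  have "\<nu>\<^sub>0 f \<in> center_of UNIV" for f
  proof -
    have "\<nu>\<^sub>0 f = (\<Sum>(u, v)\<in>{(u, v). u \<le> v}. coef f u v *\<^sub>K \<nu>\<^sub>0 (bas u v))"
      by (subst incidence_expansion) (simp add: nu.sum nu.scale split_beta)
    also have "\<dots> \<in> center_of UNIV"
    proof (rule incidence.subspace_sum[OF sub], clarify)
      fix u v :: 'a assume "u \<le> v"
      then show "coef f u v *\<^sub>K \<nu>\<^sub>0 (bas u v) \<in> center_of UNIV"
        using nu0_bas_less[of u v] nu0_bas_diag[of u]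
        by (intro incidence.subspace_scale[OF sub])
          (cases "u = v", auto simp: order.strict_iff_order incidence.subspace_0[OF sub])
    qed
    finally show ?thesis .
  qed
  then show "range \<nu>\<^sub>0 \<subseteq> center_of UNIV" by auto
  have "\<nu>\<^sub>0 f = 0" if "f \<in> J" for f
    using that unfolding J_def by (rule nu.eq_0_on_span[rotated]) (auto simp: nu0_bas_less)
  moreover have "0 \<in> (J :: ('a, 'k) incidence set)" by (simp add: J_iff coef_simps)
  ultimately show "\<nu>\<^sub>0 ` J = {0}" by force
qed

lemma decomposition:
  "\<exists>\<beta> \<sigma> \<nu>. admissible_beta \<beta> \<and> admissible_sigma \<sigma> \<and> admissible_nu \<nu> \<and>
     \<phi> = (\<lambda>f. (\<xi> \<beta> \<circ> mult_aut \<sigma>) f + \<nu> f)"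
proof (intro exI conjI)
  show "admissible_beta (1 + j\<^sub>0)" by (rule admissible_beta_unipotent[OF j0_central])
  show "\<phi> = (\<lambda>f. (\<xi> (1 + j\<^sub>0) \<circ> mult_aut \<sigma>\<^sub>0) f + \<nu>\<^sub>0 f)"
    unfolding inner_mult_aut[OF j0_central admissible_sigma0] by (simp add: \<nu>\<^sub>0_def)
qed (rule admissible_sigma0 admissible_nu0)+

end

theorem corollary2p12:
  fixes \<phi> :: "('a::{finite,order}, 'k::field) incidence \<Rightarrow> ('a, 'k) incidence"
  assumes "connected_poset TYPE('a)"
    and "CARD('a) > 1"
    and "incidence.lie_automorphism \<phi>"
  shows "(incidence.regular_hom_lie \<phi> \<longleftrightarrow>
           (\<exists>\<beta> \<sigma> \<nu>. admissible_beta \<beta> \<and> admissible_sigma \<sigma> \<and> admissible_nu \<nu> \<and>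
              \<phi> = (\<lambda>f. (\<xi> \<beta> \<circ> mult_aut \<sigma>) f + \<nu> f))) \<and>
         (\<forall>\<beta> \<sigma> \<nu> \<beta>' \<sigma>' \<nu>'.
           admissible_beta \<beta> \<and> admissible_sigma \<sigma> \<and> admissible_nu \<nu> \<and>
             \<phi> = (\<lambda>f. (\<xi> \<beta> \<circ> mult_aut \<sigma>) f + \<nu> f) \<longrightarrow>
           admissible_beta \<beta>' \<and> admissible_sigma \<sigma>' \<and> admissible_nu \<nu>' \<and>
             \<phi> = (\<lambda>f. (\<xi> \<beta>' \<circ> mult_aut \<sigma>') f + \<nu>' f) \<longrightarrow>
           \<beta> = \<beta>' \<and> \<sigma> = \<sigma>' \<and> \<nu> = \<nu>')"
proof (intro conjI iffI allI impI)
  assume "incidence.regular_hom_lie \<phi>"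
  then interpret regular_hom_lie_incidence \<phi>
    using assms(1) by unfold_locales
  show "\<exists>\<beta> \<sigma> \<nu>. admissible_beta \<beta> \<and> admissible_sigma \<sigma> \<and> admissible_nu \<nu> \<and>
      \<phi> = (\<lambda>f. (\<xi> \<beta> \<circ> mult_aut \<sigma>) f + \<nu> f)"
    by (rule decomposition)
next
  assume "\<exists>\<beta> \<sigma> \<nu>. admissible_beta \<beta> \<and> admissible_sigma \<sigma> \<and> admissible_nu \<nu> \<and>
      \<phi> = (\<lambda>f. (\<xi> \<beta> \<circ> mult_aut \<sigma>) f + \<nu> f)"
  then show "incidence.regular_hom_lie \<phi>"
    using regular_hom_lie_inner_mult_aut[OF assms(3)] by blast
qed (use parameters_unique in blast)+

end
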